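(* Let $p$ be a prime number. (1) The group $\mathrm{Aut}\,\mathcal{A}_p(\mathrm{XOR})$ consists exactly of the functions $f:\mathbb{Z}_p\to\mathbb{Z}_p$ given in coordinate form by $$f(x_0+px_1+\ldots+p^kx_k+\ldots)=\sum_{k=0}^{\infty}p^k\varphi_k(x_0,\ldots,x_k),$$ where $\varphi_k:\{0,\ldots,p-1\}^{k+1}\to\{0,\ldots,p-1\}$ is $$\varphi_k(x_0,\ldots,x_k)=\alpha_0^{(k)}x_0\oplus_p\alpha_1^{(k)}x_1\oplus_p\ldots\oplus_p\alpha_k^{(k)}x_k$$ with $\alpha_i^{(k)}\in\{0,\ldots,p-1\}$ for $0\le i\le k$ and $\alpha_k^{(k)}\not\equiv 0\pmod p$, for all $k\ge 0$. (2) The group $\mathrm{Aut}\,\mathcal{A}_p(\mathrm{AND})$ consists exactly of the functions $f:\mathbb{Z}_p\to\mathbb{Z}_p$ given in coordinate form by $$f(x_0+px_1+\ldots+p^kx_k+\ldots)=\sum_{k=0}^{\infty}p^k\left(x_k^{s^{(k)}}\bmod p\right),$$ where the $s^{(k)}$ are positive integers with $\gcd(s^{(k)},p-1)=1$ for all $k\ge 0$.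
   Context: $\mathbb{Z}_p$ is the set of $p$-adic integers; each $x\in\mathbb{Z}_p$ is written in canonical form $x=\sum_{k\ge 0}p^kx_k$ with $x_k\in\{0,\ldots,p-1\}$. On $\{0,\ldots,p-1\}$, $\oplus_p$ and $\odot_p$ denote addition and multiplication modulo $p$ (results taken as least nonnegative residues); products $\alpha x_i$ of elements of $\{0,\ldots,p-1\}$ appearing in a $\oplus_p$-sum are taken modulo $p$, and "$\bmod\ p$" means the least nonnegative residue. The coordinate-wise logical operations on $\mathbb{Z}_p$ are $$x\,\mathrm{XOR}\,y=\sum_{k\ge 0}p^k(x_k\oplus_p y_k),\qquad x\,\mathrm{AND}\,y=\sum_{k\ge 0}p^k(x_k\odot_p y_k).$$ For a binary operation $*$ on $\mathbb{Z}_p$, $\mathcal{A}_p( * )$ denotes the algebraic system with carrier $\mathbb{Z}_p$, the single operation $*$, and the family of congruence relations modulo $p^k$ for all $k\ge 1$. An automorphism of $\mathcal{A}_p( * )$ is a bijective map $f:\mathbb{Z}_p\to\mathbb{Z}_p$ such that $f(x*y)=f(x)*f(y)$ for all $x,y\in\mathbb{Z}_p$, and such that for every $k\ge 1$ and all $x,y\in\mathbb{Z}_p$, $x\equiv y\pmod{p^k}$ implies $f(x)\equiv f(y)\pmod{p^k}$. $\mathrm{Aut}\,\mathcal{A}_p( * )$ is the group of all automorphisms of $\mathcal{A}_p( * )$ under composition. *)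

theory Defs
  imports
    "HOL-Algebra.Bij"
    "HOL-Algebra.Divisibility"
    "HOL-Number_Theory.Residues"
begin

section \<open>The ring of p-adic integers\<close>

text \<open>
  The inverse limit of the rings Z / p^n Z: a p-adic integer is a coherent sequence whose
  n-th entry is the least nonnegative residue modulo p^n.
\<close>

definition padic_ring :: "nat \<Rightarrow> (nat \<Rightarrow> int) ring" where
  "padic_ring p =
     \<lparr>carrier = {x. \<forall>n. x n \<in> {0..<int p ^ n} \<and> x (Suc n) mod int p ^ n = x n},
      monoid.mult = \<lambda>x y n. (x n * y n) mod int p ^ n,
      one = \<lambda>n. 1 mod int p ^ n,
      zero = \<lambda>n. 0,
      add = \<lambda>x y n. (x n + y n) mod int p ^ n\<rparr>"

abbreviation padic_ints :: "nat \<Rightarrow> (nat \<Rightarrow> int) set" where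
  "padic_ints p \<equiv> carrier (padic_ring p)"

text \<open>Congruence modulo p^k: the element p^k of the ring of p-adic integers divides x - y.\<close>

definition padic_cong :: "nat \<Rightarrow> nat \<Rightarrow> (nat \<Rightarrow> int) \<Rightarrow> (nat \<Rightarrow> int) \<Rightarrow> bool" where
  "padic_cong p k x y \<longleftrightarrow>
     ([p] \<cdot>\<^bsub>padic_ring p\<^esub> \<one>\<^bsub>padic_ring p\<^esub>) [^]\<^bsub>padic_ring p\<^esub> k
       divides\<^bsub>padic_ring p\<^esub> (x \<ominus>\<^bsub>padic_ring p\<^esub> y)"

text \<open>
  The sum of the series of c k * p^k; that the partial sums do converge to it is
  \<open>padic_series_limit\<close> below.
\<close>

definition padic_series :: "nat \<Rightarrow> (nat \<Rightarrow> int) \<Rightarrow> nat \<Rightarrow> int" where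
  "padic_series p c = (\<lambda>n. (\<Sum>k<n. c k * int p ^ k) mod int p ^ n)"

text \<open>
  The k-th coordinate of the canonical form; \<open>padic_canonical_form\<close> below shows that
  this is the unique expansion with coefficients in {0..p-1}.
\<close>

definition padic_digit :: "nat \<Rightarrow> (nat \<Rightarrow> int) \<Rightarrow> nat \<Rightarrow> int" where
  "padic_digit p x k = x (Suc k) div int p ^ k"


section \<open>Coordinate-wise logical operations\<close>

definition padic_XOR :: "nat \<Rightarrow> (nat \<Rightarrow> int) \<Rightarrow> (nat \<Rightarrow> int) \<Rightarrow> (nat \<Rightarrow> int)" where
  "padic_XOR p x y =
     padic_series p (\<lambda>k. padic_digit p x k \<oplus>\<^bsub>residue_ring (int p)\<^esub> padic_digit p y k)"

definition padic_AND :: "nat \<Rightarrow> (nat \<Rightarrow> int) \<Rightarrow> (nat \<Rightarrow> int) \<Rightarrow> (nat \<Rightarrow> int)" where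
  "padic_AND p x y =
     padic_series p (\<lambda>k. padic_digit p x k \<otimes>\<^bsub>residue_ring (int p)\<^esub> padic_digit p y k)"


section \<open>The automorphism group\<close>

text \<open>As in \<^const>\<open>Bij\<close>, maps on the p-adic integers are taken to be extensional.\<close>

definition padic_auto ::
  "nat \<Rightarrow> ((nat \<Rightarrow> int) \<Rightarrow> (nat \<Rightarrow> int) \<Rightarrow> (nat \<Rightarrow> int)) \<Rightarrow> ((nat \<Rightarrow> int) \<Rightarrow> (nat \<Rightarrow> int)) set"
where
  "padic_auto p opr =
     {f \<in> Bij (padic_ints p).
        (\<forall>x\<in>padic_ints p. \<forall>y\<in>padic_ints p. f (opr x y) = opr (f x) (f y)) \<and>
        (\<forall>k\<ge>1. \<forall>x\<in>padic_ints p. \<forall>y\<in>padic_ints p.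
           padic_cong p k x y \<longrightarrow> padic_cong p k (f x) (f y))}"

definition padic_AutoGroup ::
  "nat \<Rightarrow> ((nat \<Rightarrow> int) \<Rightarrow> (nat \<Rightarrow> int) \<Rightarrow> (nat \<Rightarrow> int)) \<Rightarrow> ((nat \<Rightarrow> int) \<Rightarrow> (nat \<Rightarrow> int)) monoid"
where
  "padic_AutoGroup p opr = BijGroup (padic_ints p) \<lparr>carrier := padic_auto p opr\<rparr>"


section \<open>Adequacy of the definitions\<close>

lemma padic_ints_iff:
  "x \<in> padic_ints p \<longleftrightarrow> (\<forall>n. 0 \<le> x n \<and> x n < int p ^ n \<and> x (Suc n) mod int p ^ n = x n)"
  by (auto simp: padic_ring_def)

lemma padic_intsI:
  assumes "p > 0" "\<And>n. x n = c n mod int p ^ n" "\<And>n. c (Suc n) mod int p ^ n = c n mod int p ^ n"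
  shows "x \<in> padic_ints p"
  using assms by (auto simp: padic_ints_iff mod_mod_cancel)

lemma padic_ints_mod: "x \<in> padic_ints p \<Longrightarrow> x n mod int p ^ n = x n"
  by (auto simp: padic_ints_iff)

lemma padic_ints_Suc_mod: "x \<in> padic_ints p \<Longrightarrow> x (Suc n) mod int p ^ n = x n"
  by (auto simp: padic_ints_iff)

lemma padic_ints_mod_le:
  assumes "x \<in> padic_ints p" "m \<le> n"
  shows "x n mod int p ^ m = x m"
  using assms(2)
proof (induction n rule: dec_induct)
  case base
  show ?case using assms(1) by (rule padic_ints_mod)
next
  case (step n)
  have "x (Suc n) mod int p ^ m = x (Suc n) mod int p ^ n mod int p ^ m"
    using step.hyps by (simp add: mod_mod_cancel le_imp_power_dvd)
  also have "\<dots> = x m" using assms(1) step.IH by (simp add: padic_ints_Suc_mod)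
  finally show ?case .
qed

lemma padic_ring_closed:
  assumes "p > 0" "x \<in> padic_ints p" "y \<in> padic_ints p"
  shows "(\<lambda>n. (x n + y n) mod int p ^ n) \<in> padic_ints p"
    and "(\<lambda>n. (x n * y n) mod int p ^ n) \<in> padic_ints p"
    and "(\<lambda>n. (- x n) mod int p ^ n) \<in> padic_ints p"
proof -
  have *: "x (Suc n) mod int p ^ n = x n mod int p ^ n" "y (Suc n) mod int p ^ n = y n mod int p ^ n" for n
    using assms(2,3) by (simp_all add: padic_ints_Suc_mod padic_ints_mod)
  show "(\<lambda>n. (x n + y n) mod int p ^ n) \<in> padic_ints p"
    by (rule padic_intsI[OF assms(1) refl]) (intro mod_add_cong *)
  show "(\<lambda>n. (x n * y n) mod int p ^ n) \<in> padic_ints p"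
    by (rule padic_intsI[OF assms(1) refl]) (intro mod_mult_cong *)
  show "(\<lambda>n. (- x n) mod int p ^ n) \<in> padic_ints p"
    by (rule padic_intsI[OF assms(1) refl]) (intro mod_minus_cong *)
qed

lemma padic_of_int_closed: "p > 0 \<Longrightarrow> (\<lambda>n. m mod int p ^ n) \<in> padic_ints p"
  by (rule padic_intsI[where c = "\<lambda>_. m"]) auto

lemma padic_ring_cring:
  assumes "p > 0"
  shows "cring (padic_ring p)"
proof (intro cringI abelian_groupI comm_monoidI)
  fix x assume x: "x \<in> padic_ints p"
  show "\<exists>y\<in>padic_ints p. y \<oplus>\<^bsub>padic_ring p\<^esub> x = \<zero>\<^bsub>padic_ring p\<^esub>"
    by (rule bexI[OF _ padic_ring_closed(3)[OF assms x x]])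
      (simp add: padic_ring_def mod_add_left_eq)
  show "\<zero>\<^bsub>padic_ring p\<^esub> \<oplus>\<^bsub>padic_ring p\<^esub> x = x" "\<one>\<^bsub>padic_ring p\<^esub> \<otimes>\<^bsub>padic_ring p\<^esub> x = x"
    using padic_ints_mod[OF x] by (simp_all add: padic_ring_def mod_mult_left_eq)
next
  show "\<zero>\<^bsub>padic_ring p\<^esub> \<in> padic_ints p" "\<one>\<^bsub>padic_ring p\<^esub> \<in> padic_ints p"
    using padic_of_int_closed[OF assms, of 0] padic_of_int_closed[OF assms, of 1]
    by (simp_all add: padic_ring_def)
next
  fix x y assume "x \<in> padic_ints p" "y \<in> padic_ints p"
  then show "x \<oplus>\<^bsub>padic_ring p\<^esub> y \<in> padic_ints p" "x \<otimes>\<^bsub>padic_ring p\<^esub> y \<in> padic_ints p"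
    using padic_ring_closed[OF assms] by (simp_all add: padic_ring_def)
qed (simp_all add: padic_ring_def mod_add_left_eq mod_add_right_eq mod_mult_left_eq
      mod_mult_right_eq algebra_simps)

lemma padic_ring_minus:
  assumes "p > 0" "x \<in> padic_ints p" "y \<in> padic_ints p"
  shows "x \<ominus>\<^bsub>padic_ring p\<^esub> y = (\<lambda>n. (x n - y n) mod int p ^ n)"
proof -
  interpret cring "padic_ring p" by (rule padic_ring_cring[OF assms(1)])
  let ?z = "\<lambda>n. (- y n) mod int p ^ n"
  have "\<ominus>\<^bsub>padic_ring p\<^esub> y = ?z"
  proof (rule minus_equality)
    show "?z \<in> padic_ints p" using padic_ring_closed(3)[OF assms(1,3,3)] .
    show "?z \<oplus>\<^bsub>padic_ring p\<^esub> y = \<zero>\<^bsub>padic_ring p\<^esub>"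
      by (simp add: padic_ring_def mod_add_left_eq)
  qed (rule assms)
  then show ?thesis by (simp add: a_minus_def) (simp add: padic_ring_def mod_add_right_eq)
qed

lemma padic_ring_of_nat:
  assumes "p > 0"
  shows "[m] \<cdot>\<^bsub>padic_ring p\<^esub> \<one>\<^bsub>padic_ring p\<^esub> = (\<lambda>n. int m mod int p ^ n)"
proof -
  interpret cring "padic_ring p" by (rule padic_ring_cring[OF assms])
  show ?thesis
  proof (induction m)
    case 0
    show ?case by simp (simp add: padic_ring_def)
  next
    case (Suc m)
    have "[Suc m] \<cdot>\<^bsub>padic_ring p\<^esub> \<one>\<^bsub>padic_ring p\<^esub> =
        [m] \<cdot>\<^bsub>padic_ring p\<^esub> \<one>\<^bsub>padic_ring p\<^esub> \<oplus>\<^bsub>padic_ring p\<^esub> \<one>\<^bsub>padic_ring p\<^esub>"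
      by simp
    also have "\<dots> = (\<lambda>n. int (Suc m) mod int p ^ n)"
      unfolding Suc.IH by (simp add: padic_ring_def mod_add_eq add.commute)
    finally show ?case .
  qed
qed

lemma padic_ring_of_nat_power:
  assumes "p > 0"
  shows "([m] \<cdot>\<^bsub>padic_ring p\<^esub> \<one>\<^bsub>padic_ring p\<^esub>) [^]\<^bsub>padic_ring p\<^esub> (k::nat) = (\<lambda>n. int m ^ k mod int p ^ n)"
proof -
  interpret cring "padic_ring p" by (rule padic_ring_cring[OF assms])
  show ?thesis
  proof (induction k)
    case 0
    show ?case by simp (simp add: padic_ring_def)
  next
    case (Suc k)
    have "([m] \<cdot>\<^bsub>padic_ring p\<^esub> \<one>\<^bsub>padic_ring p\<^esub>) [^]\<^bsub>padic_ring p\<^esub> Suc k =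
        (\<lambda>n. int m ^ k mod int p ^ n) \<otimes>\<^bsub>padic_ring p\<^esub> (\<lambda>n. int m mod int p ^ n)"
      using Suc.IH padic_ring_of_nat[OF assms, of m] by simp
    also have "\<dots> = (\<lambda>n. int m ^ Suc k mod int p ^ n)"
      by (simp add: padic_ring_def mod_mult_eq mult.commute)
    finally show ?case .
  qed
qed

lemma padic_cong_iff:
  assumes "p > 0" "x \<in> padic_ints p" "y \<in> padic_ints p"
  shows "padic_cong p k x y \<longleftrightarrow> x k = y k"
proof
  assume "padic_cong p k x y"
  then obtain c where "c \<in> padic_ints p"
    "(\<lambda>n. (x n - y n) mod int p ^ n) = (\<lambda>n. int p ^ k mod int p ^ n) \<otimes>\<^bsub>padic_ring p\<^esub> c"
    unfolding padic_cong_def factor_def padic_ring_of_nat_power[OF assms(1)]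
      padic_ring_minus[OF assms] by auto
  then have "(x k - y k) mod int p ^ k = 0"
    by (auto simp: padic_ring_def dest: fun_cong[of _ _ k])
  then have "x k mod int p ^ k = y k mod int p ^ k"
    using mod_eq_dvd_iff by blast
  then show "x k = y k" using assms by (simp add: padic_ints_mod)
next
  assume eq: "x k = y k"
  let ?P = "int p"
  define c where "c n = (x (n + k) - y (n + k)) div ?P ^ k" for n
  have dvd: "?P ^ k dvd x (n + k) - y (n + k)" for n
    using eq padic_ints_mod_le[OF assms(2), of k "n + k"] padic_ints_mod_le[OF assms(3), of k "n + k"]
    by (simp flip: mod_eq_dvd_iff)
  have c: "?P ^ k * c n = x (n + k) - y (n + k)" for n
    using dvd by (simp add: c_def)
  have cS: "c (Suc n) mod ?P ^ n = c n mod ?P ^ n" for n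
  proof -
    have "x (Suc n + k) mod ?P ^ (n + k) = x (n + k) mod ?P ^ (n + k)"
      "y (Suc n + k) mod ?P ^ (n + k) = y (n + k) mod ?P ^ (n + k)"
      using assms by (simp_all add: padic_ints_Suc_mod padic_ints_mod)
    then have "(?P ^ k * c (Suc n)) mod ?P ^ (n + k) = (?P ^ k * c n) mod ?P ^ (n + k)"
      unfolding c by (rule mod_diff_cong)
    then have "?P ^ k * (c (Suc n) mod ?P ^ n) = ?P ^ k * (c n mod ?P ^ n)"
      by (simp only: add.commute[of n k] power_add mod_mult_mult1)
    then show ?thesis using assms(1) by simp
  qed
  have "(\<lambda>n. c n mod ?P ^ n) \<in> padic_ints p"
    by (rule padic_intsI[OF assms(1) refl cS])
  moreover have "(\<lambda>n. (x n - y n) mod ?P ^ n) =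
      (\<lambda>n. ?P ^ k mod ?P ^ n) \<otimes>\<^bsub>padic_ring p\<^esub> (\<lambda>n. c n mod ?P ^ n)"
  proof
    fix n
    have "(x n - y n) mod ?P ^ n = (x (n + k) - y (n + k)) mod ?P ^ n"
      using padic_ints_mod_le[OF assms(2), of n "n + k"] padic_ints_mod_le[OF assms(3), of n "n + k"]
        padic_ints_mod[OF assms(2), of n] padic_ints_mod[OF assms(3), of n]
      by (intro mod_diff_cong) simp_all
    then show "(x n - y n) mod ?P ^ n =
        ((\<lambda>n. ?P ^ k mod ?P ^ n) \<otimes>\<^bsub>padic_ring p\<^esub> (\<lambda>n. c n mod ?P ^ n)) n"
      by (simp add: padic_ring_def mod_mult_eq c)
  qed
  ultimately show "padic_cong p k x y"
    unfolding padic_cong_def factor_def padic_ring_of_nat_power[OF assms(1)]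
      padic_ring_minus[OF assms] by blast
qed

lemma padic_series_closed:
  assumes "p > 0"
  shows "padic_series p c \<in> padic_ints p"
  by (rule padic_intsI[OF assms, where c = "\<lambda>n. \<Sum>k<n. c k * int p ^ k"])
    (simp_all add: padic_series_def)

lemma padic_series_limit:
  assumes "p > 0" "m \<le> N"
  shows "padic_cong p m (\<lambda>n. (\<Sum>k<N. c k * int p ^ k) mod int p ^ n) (padic_series p c)"
proof -
  have "(\<Sum>k<N. c k * int p ^ k) mod int p ^ m = padic_series p c N mod int p ^ m"
    using assms(2) by (simp add: padic_series_def mod_mod_cancel le_imp_power_dvd)
  also have "\<dots> = padic_series p c m"
    by (rule padic_ints_mod_le[OF padic_series_closed[OF assms(1)] assms(2)])
  finally show ?thesis
    by (simp add: padic_cong_iff[OF assms(1) padic_of_int_closed[OF assms(1)] padic_series_closed[OF assms(1)]])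
qed

lemma padic_digit_range:
  assumes "p > 0" "x \<in> padic_ints p"
  shows "padic_digit p x k \<in> {0..<int p}"
proof -
  have "0 \<le> x (Suc k)" "x (Suc k) < int p * int p ^ k"
    using assms(2) by (auto simp: padic_ints_iff simp flip: power_Suc)
  moreover have "x (Suc k) div int p ^ k * int p ^ k < int p * int p ^ k"
  proof -
    have "x (Suc k) div int p ^ k * int p ^ k + x (Suc k) mod int p ^ k = x (Suc k)"
      by (rule div_mult_mod_eq)
    moreover have "0 \<le> x (Suc k) mod int p ^ k"
      using assms(1) by simp
    ultimately show ?thesis using \<open>x (Suc k) < int p * int p ^ k\<close> by linarith
  qed
  ultimately show ?thesis using assms(1)
    by (simp add: padic_digit_def pos_imp_zdiv_nonneg_iff)
qed

lemma padic_series_digit: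
  assumes "p > 0" "x \<in> padic_ints p"
  shows "padic_series p (padic_digit p x) = x"
proof
  fix n
  have "(\<Sum>k<n. padic_digit p x k * int p ^ k) = x n"
  proof (induction n)
    case 0
    show ?case using assms(2) by (auto simp: padic_ints_iff dest: spec[of _ 0])
  next
    case (Suc n)
    have "x (Suc n) div int p ^ n * int p ^ n + x (Suc n) mod int p ^ n = x (Suc n)"
      by (rule div_mult_mod_eq)
    then show ?case using Suc assms(2) by (simp add: padic_digit_def padic_ints_Suc_mod)
  qed
  then show "padic_series p (padic_digit p x) n = x n"
    using assms(2) by (simp add: padic_series_def padic_ints_mod)
qed

lemma padic_digit_series:
  assumes "p > 0" "\<And>k. c k \<in> {0..<int p}"
  shows "padic_digit p (padic_series p c) k = c k"
proof -
  have less: "0 \<le> (\<Sum>k<n. c k * int p ^ k) \<and> (\<Sum>k<n. c k * int p ^ k) < int p ^ n" for n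
  proof (induction n)
    case (Suc n)
    have "(c n + 1) * int p ^ n \<le> int p * int p ^ n"
      using assms(2)[of n] by (intro mult_right_mono) auto
    moreover have "0 \<le> c n * int p ^ n"
      using assms(2)[of n] by simp
    ultimately show ?case using Suc by (simp add: distrib_right)
  qed simp
  have "padic_digit p (padic_series p c) k = (\<Sum>k<Suc k. c k * int p ^ k) div int p ^ k"
    unfolding padic_digit_def padic_series_def using less[of "Suc k"] by simp
  also have "\<dots> = c k"
    using less[of k] assms(1) by simp
  finally show ?thesis .
qed

lemma padic_canonical_form:
  assumes "p > 0" "x \<in> padic_ints p"
  shows "(\<forall>k. c k \<in> {0..<int p}) \<and> x = padic_series p c \<longleftrightarrow> c = padic_digit p x"
  using padic_digit_series[OF assms(1), of c] padic_series_digit[OF assms] padic_digit_range[OF assms]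
  by auto

lemma padic_XOR_closed: "p > 0 \<Longrightarrow> padic_XOR p x y \<in> padic_ints p"
  and padic_AND_closed: "p > 0 \<Longrightarrow> padic_AND p x y \<in> padic_ints p"
  by (simp_all add: padic_XOR_def padic_AND_def padic_series_closed)

lemma padic_auto_cong_iff:
  assumes "p > 0" "f \<in> padic_auto p opr" "k \<ge> 1" "x \<in> padic_ints p" "y \<in> padic_ints p"
  shows "padic_cong p k (f x) (f y) \<longleftrightarrow> padic_cong p k x y"
proof -
  let ?Z = "padic_ints p" and ?A = "{0..<int p ^ k}"
  let ?e = "\<lambda>m n. m mod int p ^ n"
  have f: "f \<in> ?Z \<rightarrow> ?Z" "f ` ?Z = ?Z"
    using assms(2) by (auto simp: padic_auto_def Bij_def bij_betw_def)
  have e: "?e m \<in> ?Z" for m by (rule padic_of_int_closed[OF assms(1)])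
  have f_cong: "f u k = f v k" if "u \<in> ?Z" "v \<in> ?Z" "u k = v k" for u v
  proof -
    have "padic_cong p k u v" using that assms(1) by (simp add: padic_cong_iff)
    then have "padic_cong p k (f u) (f v)" using that assms(2,3) unfolding padic_auto_def by blast
    then show ?thesis using that f(1) assms(1) by (simp add: padic_cong_iff Pi_iff)
  qed
  define g where "g m = f (?e m) k" for m
  have g: "f u k = g (u k)" if "u \<in> ?Z" for u
    unfolding g_def by (rule f_cong[OF that e]) (simp only: padic_ints_mod[OF that])
  have range: "u k \<in> ?A" if "u \<in> ?Z" for u using that by (auto simp: padic_ints_iff)
  have "?A \<subseteq> g ` ?A"
  proof
    fix m assume m: "m \<in> ?A"
    obtain u where u: "u \<in> ?Z" "f u = ?e m" using e[of m] f(2) by (metis imageE)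
    have "m = f u k" using m u(2) by simp
    then show "m \<in> g ` ?A" using g[OF u(1)] range[OF u(1)] by blast
  qed
  then have "inj_on g ?A"
    by (intro finite_surj_inj) simp_all
  then have "f x k = f y k \<longleftrightarrow> x k = y k"
    using range[OF assms(4)] range[OF assms(5)]
    unfolding g[OF assms(4)] g[OF assms(5)] by (rule inj_on_eq_iff)
  then show ?thesis using f(1) assms(1,4,5) by (simp add: padic_cong_iff Pi_iff)
qed

lemma padic_AutoGroup_group:
  assumes "p > 0" "\<And>x y. x \<in> padic_ints p \<Longrightarrow> y \<in> padic_ints p \<Longrightarrow> opr x y \<in> padic_ints p"
  shows "group (padic_AutoGroup p opr)"
proof -
  let ?Z = "padic_ints p"
  have "subgroup (padic_auto p opr) (BijGroup ?Z)"
  proof (rule subgroup.intro)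
    show "padic_auto p opr \<subseteq> carrier (BijGroup ?Z)"
      by (auto simp: padic_auto_def BijGroup_def)
    show "\<one>\<^bsub>BijGroup ?Z\<^esub> \<in> padic_auto p opr"
      using assms(2) by (simp add: padic_auto_def BijGroup_def id_Bij)
  next
    fix f g assume fg: "f \<in> padic_auto p opr" "g \<in> padic_auto p opr"
    then have B: "f \<in> Bij ?Z" "g \<in> Bij ?Z" by (auto simp: padic_auto_def)
    then have Z: "g x \<in> ?Z" if "x \<in> ?Z" for x using that Bij_imp_funcset by blast
    show "f \<otimes>\<^bsub>BijGroup ?Z\<^esub> g \<in> padic_auto p opr"
      using fg B Z assms(2) by (simp add: BijGroup_def padic_auto_def compose_Bij compose_eq)
  next
    fix f assume f: "f \<in> padic_auto p opr"
    then have B: "f \<in> Bij ?Z" by (auto simp: padic_auto_def)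
    let ?h = "inv_into ?Z f"
    have h: "?h x \<in> ?Z" "f (?h x) = x" if "x \<in> ?Z" for x
      using that B by (auto simp: Bij_inv_into_mem Bij_def bij_betw_def f_inv_into_f)
    have opr: "?h (opr x y) = opr (?h x) (?h y)" if "x \<in> ?Z" "y \<in> ?Z" for x y
      using that f B assms(2) by (intro Bij_inv_into_lemma) (auto simp: padic_auto_def)
    have cong: "padic_cong p k (?h x) (?h y)" if "k \<ge> 1" "x \<in> ?Z" "y \<in> ?Z" "padic_cong p k x y" for k x y
      using that h padic_auto_cong_iff[OF assms(1) f that(1), of "?h x" "?h y"] by simp
    show "inv\<^bsub>BijGroup ?Z\<^esub> f \<in> padic_auto p opr"
      using restrict_inv_into_Bij[OF B] opr cong assms(2)
      by (simp add: inv_BijGroup[OF B] padic_auto_def)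
  qed
  then show ?thesis
    unfolding padic_AutoGroup_def by (rule subgroup.subgroup_is_group[OF _ group_BijGroup])
qed

end

theory Submission
  imports Defs "HOL-Number_Theory.Residue_Primitive_Roots"
begin

text \<open>
  An automorphism is a bijection compatible with every congruence. Counting residues modulo
  \<open>p ^ k\<close> shows that it also reflects congruences, so it is an isometry: its k-th digit is a function
  \<open>\<phi> k\<close> of the digits up to k, injective in the k-th one when the lower ones are fixed. Conversely
  every such triangular system of digit functions is an isometry, and isometries of the p-adic
  integers are automatically onto. As both operations act digit by digit, being an automorphism
  means precisely that, in addition, every \<open>\<phi> k\<close> is a homomorphism from the digit sequences
  to the digits (\<open>padic_auto_digitwise\<close>). What remains is to find these
  homomorphisms over the prime field.

  For XOR, \<open>\<phi> k\<close> is additive, and an additive function of finitely many elements of a prime field is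
  a linear form. Injectivity in the last digit says that the last coefficient is nonzero
  (\<open>padic_auto_XOR\<close>).

  For AND, let \<open>e\<close> be the sequence with the single nonzero digit 1 at place k. Restricted to the
  multiples \<open>a * e\<close>, the function \<open>\<phi> k\<close> is an injective multiplicative self-map of the prime
  field, which fixes 0 and 1 and is a power map because the unit group is cyclic
  (\<open>multiplicative_injection_is_power\<close>). In particular \<open>\<phi> k e = 1\<close>, whence
  \<open>\<phi> k c = \<phi> k c * \<phi> k e = \<phi> k (c * e)\<close>, which is the value on a multiple of \<open>e\<close>; so only the k-th digit
  of \<open>c\<close> matters (\<open>padic_auto_AND\<close>). The power map with exponent s is injective on the prime field
  exactly if s is coprime to \<open>p - 1\<close>.
\<close>

section \<open>Digit sequences and isometries\<close>

definition digit_seqs :: "nat \<Rightarrow> (nat \<Rightarrow> int) set" where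
  "digit_seqs p = {c. \<forall>k. c k \<in> {0..<int p}}"

lemma digit_seqs_D: "c \<in> digit_seqs p \<Longrightarrow> 0 \<le> c k \<and> c k < int p"
  by (auto simp: digit_seqs_def)

lemma padic_digit_in_digit_seqs:
  "p > 0 \<Longrightarrow> x \<in> padic_ints p \<Longrightarrow> padic_digit p x \<in> digit_seqs p"
  using padic_digit_range by (simp add: digit_seqs_def)

lemma padic_digit_of_series:
  "p > 0 \<Longrightarrow> c \<in> digit_seqs p \<Longrightarrow> padic_digit p (padic_series p c) = c"
  using padic_digit_series by (auto simp: digit_seqs_def)

lemma padic_residue_eq_iff_digits:
  assumes "p > 0" "x \<in> padic_ints p" "y \<in> padic_ints p"
  shows "x n = y n \<longleftrightarrow> (\<forall>i<n. padic_digit p x i = padic_digit p y i)"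
proof
  assume eq: "x n = y n"
  show "\<forall>i<n. padic_digit p x i = padic_digit p y i"
  proof (intro allI impI)
    fix i assume "i < n"
    then have "x (Suc i) = y (Suc i)"
      using eq padic_ints_mod_le[OF assms(2), of "Suc i" n] padic_ints_mod_le[OF assms(3), of "Suc i" n]
      by simp
    then show "padic_digit p x i = padic_digit p y i" by (simp add: padic_digit_def)
  qed
next
  assume "\<forall>i<n. padic_digit p x i = padic_digit p y i"
  then have "padic_series p (padic_digit p x) n = padic_series p (padic_digit p y) n"
    by (simp add: padic_series_def)
  then show "x n = y n" using assms by (simp add: padic_series_digit)
qed

text \<open>
  Modulo each power of p, an isometry is an injection of a finite set into itself, hence hits
  every residue class; by injectivity again the preimages modulo the various powers are coherent,
  so they assemble to a p-adic preimage. Surjectivity thus comes for free.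
\<close>

lemma padic_isometry_Bij:
  assumes p: "p > 0" and f: "f \<in> padic_ints p \<rightarrow> padic_ints p" "f \<in> extensional (padic_ints p)"
    and iso: "\<And>x y n. x \<in> padic_ints p \<Longrightarrow> y \<in> padic_ints p \<Longrightarrow> f x n = f y n \<longleftrightarrow> x n = y n"
  shows "f \<in> Bij (padic_ints p)"
proof -
  let ?Z = "padic_ints p"
  let ?e = "\<lambda>m n. m mod int p ^ n"
  have e: "?e m \<in> ?Z" for m by (rule padic_of_int_closed[OF p])
  have inj: "inj_on f ?Z"
  proof (rule inj_onI)
    fix x y assume "x \<in> ?Z" "y \<in> ?Z" "f x = f y"
    then show "x = y" using iso[of x y] by auto
  qed
  have "y \<in> f ` ?Z" if y: "y \<in> ?Z" for y
  proof -
    have "\<exists>m\<in>{0..<int p ^ n}. f (?e m) n = y n" for n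
    proof -
      have "inj_on (\<lambda>m. f (?e m) n) {0..<int p ^ n}"
        by (rule inj_onI) (use iso[OF e e] in simp)
      moreover have "(\<lambda>m. f (?e m) n) ` {0..<int p ^ n} \<subseteq> {0..<int p ^ n}"
        using f(1) e by (fastforce simp: padic_ints_iff Pi_iff)
      ultimately have "(\<lambda>m. f (?e m) n) ` {0..<int p ^ n} = {0..<int p ^ n}"
        by (intro endo_inj_surj) simp_all
      moreover have "y n \<in> {0..<int p ^ n}" using y by (auto simp: padic_ints_iff)
      ultimately show ?thesis by (metis (no_types, lifting) imageE)
    qed
    then obtain x where x: "x n \<in> {0..<int p ^ n}" "f (?e (x n)) n = y n" for n by metis
    have x_mod: "x (Suc n) mod int p ^ n = x n" for n
    proof -
      have fZ: "f (?e (x (Suc n))) \<in> ?Z" using f(1) e by blast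
      have "f (?e (x (Suc n))) n = f (?e (x n)) n"
        using padic_ints_Suc_mod[OF fZ, of n] padic_ints_Suc_mod[OF y, of n] x(2) by metis
      then show ?thesis using iso[OF e e, of "x (Suc n)" n "x n"] x(1)[of n] by simp
    qed
    then have xZ: "x \<in> ?Z" using x(1) by (auto simp: padic_ints_iff)
    have "f x n = y n" for n
      using iso[OF xZ e, of n "x n"] x[of n] by simp
    then have "f x = y" by blast
    then show ?thesis using xZ by blast
  qed
  then have "f ` ?Z = ?Z" using f(1) by blast
  then show ?thesis using inj f(2) by (simp add: Bij_def bij_betw_def)
qed

text \<open>
  Having this at all levels n, including the trivial level 0, is what makes a comparison of
  consecutive levels isolate the k-th digit for every k.
\<close>

lemma padic_auto_isometry:
  assumes p: "p > 0" and f: "f \<in> padic_auto p opr" and x: "x \<in> padic_ints p" and y: "y \<in> padic_ints p"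
  shows "f x n = f y n \<longleftrightarrow> x n = y n"
proof (cases "n = 0")
  case True
  have "u 0 = 0" if "u \<in> padic_ints p" for u
    using that by (auto simp: padic_ints_iff dest: spec[of _ 0])
  moreover have "f x \<in> padic_ints p" "f y \<in> padic_ints p"
    using f x y Bij_imp_funcset by (auto simp: padic_auto_def)
  ultimately show ?thesis using True x y by metis
next
  case False
  moreover have "f x \<in> padic_ints p" "f y \<in> padic_ints p"
    using f x y Bij_imp_funcset by (auto simp: padic_auto_def)
  ultimately show ?thesis
    using padic_auto_cong_iff[OF p f _ x y, of n] p x y by (simp add: padic_cong_iff)
qed


section \<open>Automorphisms in coordinates\<close>

definition digit_map :: "nat \<Rightarrow> (nat \<Rightarrow> (nat \<Rightarrow> int) \<Rightarrow> int) \<Rightarrow> (nat \<Rightarrow> int) \<Rightarrow> (nat \<Rightarrow> int)" where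
  "digit_map p \<phi> = (\<lambda>x\<in>padic_ints p. padic_series p (\<lambda>k. \<phi> k (padic_digit p x)))"

text \<open>
  The single equivalence below packs two facts together: by its right-to-left direction the k-th
  coordinate depends on the digits up to k only, and by the other direction it is injective in the
  k-th digit once the lower ones are fixed.
\<close>

definition triangular_coords :: "nat \<Rightarrow> (nat \<Rightarrow> (nat \<Rightarrow> int) \<Rightarrow> int) \<Rightarrow> bool" where
  "triangular_coords p \<phi> \<longleftrightarrow>
     (\<forall>k. \<forall>c\<in>digit_seqs p. \<phi> k c \<in> {0..<int p}) \<and>
     (\<forall>k. \<forall>c\<in>digit_seqs p. \<forall>d\<in>digit_seqs p.
        (\<forall>i<k. c i = d i) \<longrightarrow> (\<phi> k c = \<phi> k d \<longleftrightarrow> c k = d k))"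

lemma triangular_coords_range:
  "triangular_coords p \<phi> \<Longrightarrow> c \<in> digit_seqs p \<Longrightarrow> 0 \<le> \<phi> k c \<and> \<phi> k c < int p"
  by (auto simp: triangular_coords_def)

lemma triangular_coords_iff:
  "triangular_coords p \<phi> \<Longrightarrow> c \<in> digit_seqs p \<Longrightarrow> d \<in> digit_seqs p \<Longrightarrow>
   (\<And>i. i < k \<Longrightarrow> c i = d i) \<Longrightarrow> \<phi> k c = \<phi> k d \<longleftrightarrow> c k = d k"
  by (auto simp: triangular_coords_def)

lemma digit_map_cong:
  assumes "p > 0" "\<And>k c. c \<in> digit_seqs p \<Longrightarrow> \<phi> k c = \<psi> k c"
  shows "digit_map p \<phi> = digit_map p \<psi>"
  using assms padic_digit_in_digit_seqs[of p]
  by (auto simp: digit_map_def restrict_def fun_eq_iff)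

lemma padic_digit_digit_map:
  assumes "p > 0" "triangular_coords p \<phi>" "x \<in> padic_ints p"
  shows "padic_digit p (digit_map p \<phi> x) = (\<lambda>k. \<phi> k (padic_digit p x))"
proof -
  have "(\<lambda>k. \<phi> k (padic_digit p x)) \<in> digit_seqs p"
    using triangular_coords_range[OF assms(2) padic_digit_in_digit_seqs[OF assms(1,3)]]
    by (simp add: digit_seqs_def)
  then show ?thesis using assms by (simp add: digit_map_def padic_digit_of_series)
qed

lemma digit_map_isometry:
  assumes p: "p > 0" and tri: "triangular_coords p \<phi>"
    and x: "x \<in> padic_ints p" and y: "y \<in> padic_ints p"
  shows "digit_map p \<phi> x n = digit_map p \<phi> y n \<longleftrightarrow> x n = y n"
proof -
  let ?c = "padic_digit p x" and ?d = "padic_digit p y"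
  have cd: "?c \<in> digit_seqs p" "?d \<in> digit_seqs p"
    using padic_digit_in_digit_seqs p x y by auto
  have closed: "digit_map p \<phi> x \<in> padic_ints p" "digit_map p \<phi> y \<in> padic_ints p"
    using p x y by (simp_all add: digit_map_def padic_series_closed)
  have "(\<forall>i<n. \<phi> i ?c = \<phi> i ?d) \<longleftrightarrow> (\<forall>i<n. ?c i = ?d i)"
  proof
    assume eq: "\<forall>i<n. \<phi> i ?c = \<phi> i ?d"
    have "i < n \<Longrightarrow> ?c i = ?d i" for i
    proof (induction i rule: less_induct)
      case (less i)
      then show ?case using eq triangular_coords_iff[OF tri cd, of i] by auto
    qed
    then show "\<forall>i<n. ?c i = ?d i" by blast
  next
    assume "\<forall>i<n. ?c i = ?d i"
    then show "\<forall>i<n. \<phi> i ?c = \<phi> i ?d" using triangular_coords_iff[OF tri cd] by auto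
  qed
  then show ?thesis
    using padic_residue_eq_iff_digits[OF p closed, of n] padic_residue_eq_iff_digits[OF p x y, of n]
    by (simp add: padic_digit_digit_map[OF p tri] x y)
qed

text \<open>
  The coordinate functions of an automorphism f are read off by applying f to the p-adic integer
  with given digits; triangularity compares the isometry property at the levels k and k + 1.
  Conversely, triangularity alone makes a digit map a bijection compatible with all congruences.
\<close>

lemma padic_auto_digitwise:
  assumes p: "p > 0"
    and opr: "\<And>x y. opr x y = padic_series p (\<lambda>k. g (padic_digit p x k) (padic_digit p y k))"
    and g: "\<And>a b. a \<in> {0..<int p} \<Longrightarrow> b \<in> {0..<int p} \<Longrightarrow> g a b \<in> {0..<int p}"
  shows "padic_auto p opr =
    {f. \<exists>\<phi>. triangular_coords p \<phi> \<and>
       (\<forall>k. \<forall>c\<in>digit_seqs p. \<forall>d\<in>digit_seqs p. \<phi> k (\<lambda>i. g (c i) (d i)) = g (\<phi> k c) (\<phi> k d)) \<and>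
       f = digit_map p \<phi>}"
    (is "_ = ?R")
proof (intro equalityI subsetI)
  have g_seq: "(\<lambda>i. g (c i) (d i)) \<in> digit_seqs p" if "c \<in> digit_seqs p" "d \<in> digit_seqs p" for c d
    using that g by (simp add: digit_seqs_def)
  let ?Z = "padic_ints p"
  {
    fix f assume f: "f \<in> padic_auto p opr"
    then have fZ: "f x \<in> ?Z" if "x \<in> ?Z" for x
      using that Bij_imp_funcset by (auto simp: padic_auto_def)
    define \<phi> where "\<phi> k c = padic_digit p (f (padic_series p c)) k" for k c
    have SZ: "padic_series p c \<in> ?Z" for c by (rule padic_series_closed[OF p])
    have "triangular_coords p \<phi>"
      unfolding triangular_coords_def
    proof (intro conjI allI ballI impI)
      fix k c show "\<phi> k c \<in> {0..<int p}"
        unfolding \<phi>_def by (rule padic_digit_range[OF p fZ[OF SZ]])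
    next
      fix k c d assume cd: "c \<in> digit_seqs p" "d \<in> digit_seqs p" and eq: "\<forall>i<k. c i = d i"
      let ?x = "padic_series p c" and ?y = "padic_series p d"
      have *: "(\<forall>i<n. \<phi> i c = \<phi> i d) \<longleftrightarrow> (\<forall>i<n. c i = d i)" for n
        using padic_auto_isometry[OF p f SZ SZ, of c n d]
          padic_residue_eq_iff_digits[OF p fZ[OF SZ] fZ[OF SZ], of c n d]
          padic_residue_eq_iff_digits[OF p SZ SZ, of c n d] p cd
        by (simp add: \<phi>_def padic_digit_of_series)
      show "\<phi> k c = \<phi> k d \<longleftrightarrow> c k = d k"
        using *[of k] *[of "Suc k"] eq by (auto simp: less_Suc_eq)
    qed
    moreover have "\<phi> k (\<lambda>i. g (c i) (d i)) = g (\<phi> k c) (\<phi> k d)"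
      if cd: "c \<in> digit_seqs p" "d \<in> digit_seqs p" for k c d
    proof -
      have "padic_series p (\<lambda>i. g (c i) (d i)) = opr (padic_series p c) (padic_series p d)"
        using p cd by (simp add: opr padic_digit_of_series)
      then have "f (padic_series p (\<lambda>i. g (c i) (d i))) = opr (f (padic_series p c)) (f (padic_series p d))"
        using f SZ by (simp add: padic_auto_def)
      moreover have "(\<lambda>i. g (\<phi> i c) (\<phi> i d)) \<in> digit_seqs p"
        using padic_digit_in_digit_seqs[OF p fZ[OF SZ]] g_seq unfolding \<phi>_def by blast
      ultimately show ?thesis
        using padic_digit_of_series[OF p, of "\<lambda>i. g (\<phi> i c) (\<phi> i d)"]
        by (simp add: \<phi>_def opr)
    qed
    moreover have "f = digit_map p \<phi>"
    proof
      fix x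
      show "f x = digit_map p \<phi> x"
      proof (cases "x \<in> ?Z")
        case True
        then show ?thesis
          using p padic_series_digit[OF p fZ[OF True]]
          by (simp add: digit_map_def \<phi>_def padic_series_digit)
      next
        case False
        moreover have "f \<in> extensional ?Z" using f by (simp add: padic_auto_def Bij_def)
        ultimately show ?thesis using extensional_arb[of f ?Z x] by (simp add: digit_map_def)
      qed
    qed
    ultimately show "f \<in> ?R" by blast
  next
    fix f assume "f \<in> ?R"
    then obtain \<phi> where tri: "triangular_coords p \<phi>"
      and hom: "\<And>k c d. c \<in> digit_seqs p \<Longrightarrow> d \<in> digit_seqs p \<Longrightarrow>
        \<phi> k (\<lambda>i. g (c i) (d i)) = g (\<phi> k c) (\<phi> k d)"
      and f: "f = digit_map p \<phi>" by blast
    have fZ: "f x \<in> ?Z" if "x \<in> ?Z" for x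
      using that p by (simp add: f digit_map_def padic_series_closed)
    have iso: "f x n = f y n \<longleftrightarrow> x n = y n" if "x \<in> ?Z" "y \<in> ?Z" for x y n
      unfolding f by (rule digit_map_isometry[OF p tri that])
    have "f \<in> Bij ?Z"
    proof (rule padic_isometry_Bij[OF p])
      show "f \<in> ?Z \<rightarrow> ?Z" using fZ by blast
      show "f \<in> extensional ?Z" by (simp add: f digit_map_def)
      show "f x n = f y n \<longleftrightarrow> x n = y n" if "x \<in> ?Z" "y \<in> ?Z" for x y n by (rule iso[OF that])
    qed
    moreover have "f (opr x y) = opr (f x) (f y)" if x: "x \<in> ?Z" and y: "y \<in> ?Z" for x y
    proof -
      have c: "padic_digit p x \<in> digit_seqs p" and d: "padic_digit p y \<in> digit_seqs p"
        using x y p padic_digit_in_digit_seqs by auto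
      have "opr x y \<in> ?Z" by (simp add: opr padic_series_closed p)
      moreover have "padic_digit p (opr x y) = (\<lambda>k. g (padic_digit p x k) (padic_digit p y k))"
        unfolding opr by (rule padic_digit_of_series[OF p g_seq[OF c d]])
      ultimately have "f (opr x y) =
          padic_series p (\<lambda>k. g (\<phi> k (padic_digit p x)) (\<phi> k (padic_digit p y)))"
        using hom[OF c d] by (simp add: f digit_map_def)
      also have "\<dots> = opr (f x) (f y)"
        unfolding opr f by (simp add: padic_digit_digit_map[OF p tri] x y)
      finally show ?thesis .
    qed
    moreover have "padic_cong p k (f x) (f y)" if "x \<in> ?Z" "y \<in> ?Z" "padic_cong p k x y" for k x y
      using that iso fZ p by (simp add: padic_cong_iff)
    ultimately show "f \<in> padic_auto p opr" by (simp add: padic_auto_def)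
  }
qed

definition unit_digits :: "nat \<Rightarrow> nat \<Rightarrow> int" where
  "unit_digits i = (\<lambda>j. if j = i then 1 else 0)"

lemma scaled_unit_digits_in_digit_seqs:
  "a \<in> {0..<int p} \<Longrightarrow> (\<lambda>j. a * unit_digits i j) \<in> digit_seqs p"
  by (auto simp: digit_seqs_def unit_digits_def)


section \<open>Additive coordinates\<close>

lemma additive_coords_zero:
  assumes p: "p > 0" and tri: "triangular_coords p \<phi>"
    and add: "\<And>c d. c \<in> digit_seqs p \<Longrightarrow> d \<in> digit_seqs p \<Longrightarrow>
      \<phi> k (\<lambda>i. (c i + d i) mod int p) = (\<phi> k c + \<phi> k d) mod int p"
  shows "\<phi> k (\<lambda>_. 0) = 0"
proof -
  let ?z = "\<phi> k (\<lambda>_. 0)"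
  have z: "(\<lambda>_. 0) \<in> digit_seqs p" using p by (simp add: digit_seqs_def)
  have range: "0 \<le> ?z \<and> ?z < int p" by (rule triangular_coords_range[OF tri z])
  have "?z = (?z + ?z) mod int p" using add[OF z z] by simp
  then have "(?z + ?z) mod int p = ?z mod int p" using range by simp
  then have "int p dvd ?z + ?z - ?z" by (simp only: mod_eq_dvd_iff)
  then show ?thesis using range zdvd_not_zless[of ?z "int p"] by (cases "?z = 0") auto
qed

text \<open>
  An additive function on digit sequences with values modulo p commutes with scaling by residues,
  hence is linear on sequences of finite support. A triangular one only sees the digits up to k,
  so this determines it, with its values on the unit sequences as coefficients.
\<close>

lemma additive_coords_linear:
  assumes p: "p > 1" and tri: "triangular_coords p \<phi>"
    and add: "\<And>c d. c \<in> digit_seqs p \<Longrightarrow> d \<in> digit_seqs p \<Longrightarrow>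
      \<phi> k (\<lambda>i. (c i + d i) mod int p) = (\<phi> k c + \<phi> k d) mod int p"
    and c: "c \<in> digit_seqs p"
  shows "\<phi> k c = (\<Sum>i\<le>k. \<phi> k (unit_digits i) * c i) mod int p"
proof -
  have unit: "unit_digits i \<in> digit_seqs p" for i
    using p by (auto simp: digit_seqs_def unit_digits_def)
  have zero: "\<phi> k (\<lambda>_. 0) = 0"
    by (rule additive_coords_zero[of p \<phi> k]) (use p tri add in auto)
  have scale: "\<phi> k (\<lambda>j. int a * unit_digits i j) = \<phi> k (unit_digits i) * int a mod int p"
    if "a < p" for a i
    using that
  proof (induction a)
    case 0
    then show ?case by (simp add: zero)
  next
    case (Suc a)
    let ?u = "\<lambda>j. int a * unit_digits i j"
    have u: "?u \<in> digit_seqs p"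
      using Suc.prems scaled_unit_digits_in_digit_seqs[of "int a" p i] by simp
    have "(\<lambda>j. int (Suc a) * unit_digits i j) = (\<lambda>j. (?u j + unit_digits i j) mod int p)"
      using Suc.prems by (auto simp: unit_digits_def fun_eq_iff)
    then have "\<phi> k (\<lambda>j. int (Suc a) * unit_digits i j) = (\<phi> k ?u + \<phi> k (unit_digits i)) mod int p"
      using add[OF u unit] by simp
    also have "\<dots> = (\<phi> k (unit_digits i) * int a + \<phi> k (unit_digits i)) mod int p"
      using Suc by (simp add: mod_add_left_eq)
    finally show ?case by (simp add: algebra_simps)
  qed
  \<comment> \<open>Truncations of c, which grow by one scaled unit sequence at a time.\<close>
  define t where "t n = (\<lambda>j. if j < n then c j else 0)" for n
  have t: "t n \<in> digit_seqs p" for n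
    using c p by (auto simp: digit_seqs_def t_def)
  have "\<phi> k (t n) = (\<Sum>i<n. \<phi> k (unit_digits i) * c i) mod int p" for n
  proof (induction n)
    case 0
    then show ?case by (simp add: t_def zero)
  next
    case (Suc n)
    let ?u = "\<lambda>j. c n * unit_digits n j"
    have u: "?u \<in> digit_seqs p"
      using digit_seqs_D[OF c, of n] by (intro scaled_unit_digits_in_digit_seqs) auto
    have "t (Suc n) = (\<lambda>j. (t n j + ?u j) mod int p)"
      using digit_seqs_D[OF c] p by (auto simp: t_def unit_digits_def fun_eq_iff less_Suc_eq)
    then have "\<phi> k (t (Suc n)) = (\<phi> k (t n) + \<phi> k ?u) mod int p"
      using add[OF t u] by simp
    also have "\<phi> k ?u = \<phi> k (unit_digits n) * c n mod int p"
      using scale[of "nat (c n)" n] digit_seqs_D[OF c, of n] by (simp add: nat_less_iff)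
    finally show ?case unfolding Suc by (simp add: mod_add_eq)
  qed
  from this[of "Suc k"] have "\<phi> k (t (Suc k)) = (\<Sum>i\<le>k. \<phi> k (unit_digits i) * c i) mod int p"
    by (simp add: lessThan_Suc_atMost)
  moreover have "\<phi> k (t (Suc k)) = \<phi> k c"
    using triangular_coords_iff[OF tri t c, of k "Suc k"] by (simp add: t_def)
  ultimately show "\<phi> k c = (\<Sum>i\<le>k. \<phi> k (unit_digits i) * c i) mod int p" by simp
qed

text \<open>
  With the lower digits fixed, the linear form is affine in the k-th digit, and its slope is
  invertible modulo p.
\<close>

lemma triangular_linear_coords:
  fixes \<alpha> :: "nat \<Rightarrow> nat \<Rightarrow> int"
  assumes p: "prime p" and diag: "\<And>k. \<not> [\<alpha> k k = 0] (mod int p)"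
  shows "triangular_coords p (\<lambda>k c. (\<Sum>i\<le>k. \<alpha> k i * c i) mod int p)"
  unfolding triangular_coords_def
proof (intro conjI allI ballI impI)
  fix k c show "(\<Sum>i\<le>k. \<alpha> k i * c i) mod int p \<in> {0..<int p}"
    using prime_gt_0_nat[OF p] by simp
next
  fix k c d assume c: "c \<in> digit_seqs p" and d: "d \<in> digit_seqs p" and eq: "\<forall>i<k. c i = d i"
  have cop: "coprime (\<alpha> k k) (int p)"
    using p diag[of k] by (metis cong_0_iff coprime_commute prime_imp_coprime prime_nat_int_transfer)
  have "(\<Sum>i<k. \<alpha> k i * c i) = (\<Sum>i<k. \<alpha> k i * d i)"
    by (rule sum.cong) (use eq in auto)
  then have "(\<Sum>i\<le>k. \<alpha> k i * c i) mod int p = (\<Sum>i\<le>k. \<alpha> k i * d i) mod int p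
      \<longleftrightarrow> [\<alpha> k k * c k = \<alpha> k k * d k] (mod int p)"
    by (simp add: sum.lessThan_Suc cong_add_lcancel flip: lessThan_Suc_atMost cong_def)
  also have "\<dots> \<longleftrightarrow> [c k = d k] (mod int p)"
    by (rule cong_mult_lcancel[OF cop])
  also have "\<dots> \<longleftrightarrow> c k = d k"
    using digit_seqs_D[OF c, of k] digit_seqs_D[OF d, of k] by (simp add: cong_def)
  finally show "(\<Sum>i\<le>k. \<alpha> k i * c i) mod int p = (\<Sum>i\<le>k. \<alpha> k i * d i) mod int p \<longleftrightarrow> c k = d k" .
qed

lemma padic_auto_XOR:
  assumes p: "prime p"
  shows "padic_auto p (padic_XOR p) =
    {f. \<exists>\<alpha> :: nat \<Rightarrow> nat \<Rightarrow> int.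
       (\<forall>k. \<forall>i\<le>k. \<alpha> k i \<in> {0..int p - 1}) \<and>
       (\<forall>k. \<not> [\<alpha> k k = 0] (mod int p)) \<and>
       f = digit_map p (\<lambda>k c. (\<Sum>i\<le>k. \<alpha> k i * c i) mod int p)}"
    (is "_ = ?R")
proof -
  have p1: "p > 1" and p0: "p > 0"
    using prime_gt_1_nat[OF p] by auto
  have auto_eq: "padic_auto p (padic_XOR p) =
    {f. \<exists>\<phi>. triangular_coords p \<phi> \<and>
       (\<forall>k. \<forall>c\<in>digit_seqs p. \<forall>d\<in>digit_seqs p.
          \<phi> k (\<lambda>i. (c i + d i) mod int p) = (\<phi> k c + \<phi> k d) mod int p) \<and>
       f = digit_map p \<phi>}"
    by (rule padic_auto_digitwise) (use p0 in \<open>auto simp: padic_XOR_def residue_ring_def\<close>)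
  show ?thesis
  proof (intro equalityI subsetI)
    fix f assume "f \<in> padic_auto p (padic_XOR p)"
    then obtain \<phi> where tri: "triangular_coords p \<phi>"
      and add: "\<And>k c d. c \<in> digit_seqs p \<Longrightarrow> d \<in> digit_seqs p \<Longrightarrow>
        \<phi> k (\<lambda>i. (c i + d i) mod int p) = (\<phi> k c + \<phi> k d) mod int p"
      and f: "f = digit_map p \<phi>"
      unfolding auto_eq by blast
    define \<alpha> where "\<alpha> k i = \<phi> k (unit_digits i)" for k i
    have z: "(\<lambda>_. 0) \<in> digit_seqs p" using p0 by (simp add: digit_seqs_def)
    have unit: "unit_digits i \<in> digit_seqs p" for i
      using p1 by (auto simp: digit_seqs_def unit_digits_def)
    have range: "0 \<le> \<alpha> k i \<and> \<alpha> k i < int p" for k i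
      unfolding \<alpha>_def by (rule triangular_coords_range[OF tri unit])
    \<comment> \<open>The k-th unit sequence and the zero sequence first differ at place k.\<close>
    have "\<phi> k (unit_digits k) \<noteq> \<phi> k (\<lambda>_. 0)" for k
      using triangular_coords_iff[OF tri unit z, of k k] by (simp add: unit_digits_def)
    moreover have "\<phi> k (\<lambda>_. 0) = 0" for k
      by (rule additive_coords_zero[of p \<phi> k]) (fact p0 tri add)+
    ultimately have "\<alpha> k k \<noteq> 0" for k by (simp add: \<alpha>_def)
    then have "\<not> [\<alpha> k k = 0] (mod int p)" for k
      using range[of k k] by (simp add: cong_def)
    moreover have "\<forall>k. \<forall>i\<le>k. \<alpha> k i \<in> {0..int p - 1}"
      using range by auto
    moreover have "f = digit_map p (\<lambda>k c. (\<Sum>i\<le>k. \<alpha> k i * c i) mod int p)"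
      unfolding f \<alpha>_def
    proof (rule digit_map_cong[OF p0])
      fix k c assume c: "c \<in> digit_seqs p"
      show "\<phi> k c = (\<Sum>i\<le>k. \<phi> k (unit_digits i) * c i) mod int p"
      proof (rule additive_coords_linear[of p \<phi> k c, OF p1 tri _ c])
        fix c d assume "c \<in> digit_seqs p" "d \<in> digit_seqs p"
        then show "\<phi> k (\<lambda>i. (c i + d i) mod int p) = (\<phi> k c + \<phi> k d) mod int p" by (rule add)
      qed
    qed
    ultimately show "f \<in> ?R" by blast
  next
    fix f assume "f \<in> ?R"
    then obtain \<alpha> :: "nat \<Rightarrow> nat \<Rightarrow> int" where diag: "\<And>k. \<not> [\<alpha> k k = 0] (mod int p)"
      and f: "f = digit_map p (\<lambda>k c. (\<Sum>i\<le>k. \<alpha> k i * c i) mod int p)" by blast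
    have "(\<Sum>i\<le>k. \<alpha> k i * ((c i + d i) mod int p)) mod int p =
        ((\<Sum>i\<le>k. \<alpha> k i * c i) mod int p + (\<Sum>i\<le>k. \<alpha> k i * d i) mod int p) mod int p" for k c d
    proof -
      have "[(\<Sum>i\<le>k. \<alpha> k i * ((c i + d i) mod int p)) = (\<Sum>i\<le>k. \<alpha> k i * (c i + d i))] (mod int p)"
        by (intro cong_sum) (simp add: cong_def mod_mult_right_eq)
      then show ?thesis
        by (simp add: cong_def mod_add_eq distrib_left sum.distrib)
    qed
    then show "f \<in> padic_auto p (padic_XOR p)"
      unfolding auto_eq using triangular_linear_coords[where \<alpha> = \<alpha>, OF p diag] f by blast
  qed
qed


section \<open>Multiplicative bijections of a prime field\<close>

lemma units_mod_prime_cyclic: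
  assumes "prime p"
  obtains g :: int where "\<And>a. a \<in> {0<..<int p} \<Longrightarrow> \<exists>i. g ^ i mod int p = a"
    and "\<And>i. g ^ i mod int p = 1 \<longleftrightarrow> p - 1 dvd i"
proof -
  have p1: "p > 1" by (rule prime_gt_1_nat[OF assms])
  obtain r where r: "residue_primroot p r" using prime_primitive_root_exists[OF p1 assms] by blast
  have ord: "ord p r = p - 1" using r assms by (simp add: residue_primroot_def totient_prime)
  show thesis
  proof
    fix a assume a: "a \<in> {0<..<int p}"
    then have "nat a \<in> totatives p" using assms by (auto simp: totatives_prime)
    then have "nat a \<in> (\<lambda>i. r ^ i mod p) ` {..<totient p}"
      using residue_primroot_is_generator[OF p1 r] by (simp add: bij_betw_def)
    then obtain i where "r ^ i mod p = nat a" by auto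
    then have "int r ^ i mod int p = a" using a by (simp flip: of_nat_power of_nat_mod)
    then show "\<exists>i. int r ^ i mod int p = a" ..
  next
    fix i
    have "int r ^ i mod int p = 1 \<longleftrightarrow> r ^ i mod p = 1"
      by (metis of_nat_1 of_nat_eq_iff of_nat_mod of_nat_power)
    also have "\<dots> \<longleftrightarrow> [r ^ i = 1] (mod p)" using p1 by (simp add: cong_def)
    finally show "int r ^ i mod int p = 1 \<longleftrightarrow> p - 1 dvd i" by (simp only: ord_divides ord)
  qed
qed

text \<open>
  Off 0, a multiplicative map is determined by the image of a primitive root g, which by injectivity
  is nonzero and hence again a power of g. Were the exponent not coprime to \<open>p - 1\<close>, then a
  nontrivial power of g would be mapped to 1.
\<close>

lemma multiplicative_injection_is_power:
  assumes p: "prime p"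
    and range: "\<And>a. a \<in> {0..<int p} \<Longrightarrow> \<psi> a \<in> {0..<int p}"
    and mult: "\<And>a b. a \<in> {0..<int p} \<Longrightarrow> b \<in> {0..<int p} \<Longrightarrow> \<psi> (a * b mod int p) = \<psi> a * \<psi> b mod int p"
    and inj: "inj_on \<psi> {0..<int p}"
  shows "\<exists>s>0. gcd s (p - 1) = 1 \<and> (\<forall>a\<in>{0..<int p}. \<psi> a = a ^ s mod int p)"
proof -
  have p1: "p > 1" by (rule prime_gt_1_nat[OF p])
  have pi: "prime (int p)" using p by simp
  have in01: "0 \<in> {0..<int p}" "1 \<in> {0..<int p}" using p1 by auto
  have neq: "\<psi> 1 \<noteq> \<psi> 0" using inj_onD[OF inj _ in01(2,1)] by auto
  have cancel: "b = 1" if "a \<in> {0..<int p}" "b \<in> {0..<int p}" "a \<noteq> 0" "a * b mod int p = a" for a b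
  proof -
    have "coprime a (int p)"
      using that(1,3) pi by (metis atLeastLessThan_iff coprime_commute order_le_less prime_imp_coprime zdvd_not_zless)
    moreover have "[a * b = a * 1] (mod int p)" using that by (simp add: cong_def)
    ultimately have "[b = 1] (mod int p)" using cong_mult_lcancel by blast
    then show ?thesis using that(2) p1 by (simp add: cong_def)
  qed
  \<comment> \<open>Otherwise cancelling it in \<open>\<psi> 0 * \<psi> a = \<psi> 0\<close> would make \<open>\<psi>\<close> constant.\<close>
  have psi0: "\<psi> 0 = 0"
  proof (rule ccontr)
    assume "\<psi> 0 \<noteq> 0"
    moreover have "\<psi> 0 * \<psi> a mod int p = \<psi> 0" if "a \<in> {0..<int p}" for a
      using mult[OF in01(1) that] by simp
    ultimately have "\<psi> a = 1" if "a \<in> {0..<int p}" for a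
      using that cancel range in01(1) by blast
    then show False using neq in01 by simp
  qed
  \<comment> \<open>The only nonzero idempotent is 1.\<close>
  have psi1: "\<psi> 1 = 1"
    by (rule cancel[of "\<psi> 1"]) (use range in01 neq psi0 mult[OF in01(2,2)] p1 in auto)
  obtain g :: int where gen: "\<And>a. a \<in> {0<..<int p} \<Longrightarrow> \<exists>i. g ^ i mod int p = a"
    and ord: "\<And>i. g ^ i mod int p = 1 \<longleftrightarrow> p - 1 dvd i"
    using units_mod_prime_cyclic[OF p] by blast
  have mod_in: "a mod int p \<in> {0..<int p}" for a using p1 by simp
  have pow: "\<psi> (g ^ i mod int p) = \<psi> (g mod int p) ^ i mod int p" for i
  proof (induction i)
    case 0
    then show ?case using p1 psi1 by simp
  next
    case (Suc i)
    have "g ^ Suc i mod int p = (g mod int p) * (g ^ i mod int p) mod int p"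
      by (simp add: mod_mult_eq)
    then show ?case
      using mult[OF mod_in mod_in, of g "g ^ i"] Suc by (simp add: mod_mult_right_eq)
  qed
  have "g mod int p \<noteq> 0"
  proof
    assume "g mod int p = 0"
    then have "g ^ (p - 1) mod int p = 0" using p1 by (simp add: zero_power flip: power_mod)
    then show False using ord[of "p - 1"] by simp
  qed
  then have "\<psi> (g mod int p) \<noteq> \<psi> 0" using inj_onD[OF inj _ mod_in in01(1)] by blast
  then obtain t where t: "g ^ t mod int p = \<psi> (g mod int p)"
    using gen[of "\<psi> (g mod int p)"] range[OF mod_in, of g] psi0 by auto
  \<comment> \<open>For p = 2 the exponent t may vanish; adding p - 1 changes nothing modulo p - 1.\<close>
  define s where "s = t + (p - 1)"
  have psi_g: "\<psi> (g mod int p) = g ^ s mod int p"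
  proof -
    have "g ^ s mod int p = (g ^ t mod int p) * (g ^ (p - 1) mod int p) mod int p"
      by (simp add: s_def power_add mod_mult_eq)
    also have "g ^ (p - 1) mod int p = 1" using ord by simp
    finally show ?thesis using t by (metis mod_mod_trivial mult.right_neutral)
  qed
  have pow_s: "\<psi> (g ^ i mod int p) = g ^ (s * i) mod int p" for i
    by (simp add: pow psi_g power_mod power_mult)
  have s0: "s > 0" using p1 by (simp add: s_def)
  show ?thesis
  proof (intro exI conjI ballI)
    show "s > 0" by (rule s0)
    show "gcd s (p - 1) = 1"
    proof -
      define d where "d = gcd s (p - 1)"
      obtain m where m: "p - 1 = d * m" unfolding d_def by (metis gcd_dvd2 dvdE)
      obtain l where l: "s = d * l" unfolding d_def by (metis gcd_dvd1 dvdE)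
      have "p - 1 dvd s * m" unfolding m l by simp
      then have "\<psi> (g ^ m mod int p) = \<psi> 1" using pow_s[of m] ord psi1 by simp
      then have "g ^ m mod int p = 1" using inj_onD[OF inj _ mod_in in01(2)] by blast
      then have "d * m dvd m" using ord m by simp
      moreover have "m > 0" using m p1 by (cases m) auto
      ultimately have "d = 1" by simp
      then show ?thesis by (simp add: d_def)
    qed
  next
    fix a assume a: "a \<in> {0..<int p}"
    show "\<psi> a = a ^ s mod int p"
    proof (cases "a = 0")
      case True
      then show ?thesis using psi0 s0 by (simp add: zero_power)
    next
      case False
      then obtain i where i: "g ^ i mod int p = a" using a gen[of a] by auto
      have "\<psi> a = g ^ (s * i) mod int p" using pow_s[of i] i by simp
      also have "\<dots> = (g ^ i mod int p) ^ s mod int p"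
        by (simp add: power_mod mult.commute[of s] power_mult)
      finally show ?thesis using i by simp
    qed
  qed
qed

text \<open>
  Bezout yields u with \<open>s * u = 1\<close> modulo \<open>p - 1\<close>, and by Fermat the u-th power inverts the s-th one.
\<close>

lemma coprime_power_mod_prime_inj:
  fixes a b :: int
  assumes p: "prime p" and s: "s > 0" "gcd s (p - 1) = 1"
    and ab: "a \<in> {0..<int p}" "b \<in> {0..<int p}" and eq: "a ^ s mod int p = b ^ s mod int p"
  shows "a = b"
proof -
  obtain u v where uv: "s * u = (p - 1) * v + 1"
    using bezout_add_strong_nat[of s "p - 1"] s by (metis gcd_greatest nat_dvd_1_iff_1 not_gr0)
  have inverse: "c ^ (s * u) mod int p = c" if c: "c \<in> {0..<int p}" for c :: int
  proof (cases "c = 0")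
    case True
    then show ?thesis using uv by simp
  next
    case False
    have "\<not> p dvd nat c" using c False by (auto dest: dvd_imp_le)
    then have "[nat c ^ (p - 1) = 1] (mod p)" by (rule fermat_theorem[OF p])
    then have "[int (nat c ^ (p - 1)) = int 1] (mod int p)" by (simp only: cong_int_iff)
    then have "[c ^ (p - 1) = 1] (mod int p)" using c by simp
    then have "[(c ^ (p - 1)) ^ v * c = 1 ^ v * c] (mod int p)"
      by (intro cong_mult cong_pow cong_refl)
    then have "[c ^ (s * u) = c] (mod int p)"
      by (simp only: uv power_add power_mult power_one power_one_right mult_1_left)
    then show ?thesis using c by (simp add: cong_def)
  qed
  have "a ^ (s * u) mod int p = b ^ (s * u) mod int p"
    unfolding power_mult by (metis eq power_mod)
  then show ?thesis using inverse ab by simp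
qed


section \<open>Multiplicative coordinates\<close>

text \<open>
  On the multiples of the k-th unit sequence e, which form a copy of the multiplicative monoid of
  the prime field, the k-th coordinate is an injective multiplicative map, so it maps e to 1.
  Multiplying a sequence by e thus leaves its k-th coordinate unchanged, while it annihilates all
  digits but the k-th one.
\<close>

lemma multiplicative_coords_power:
  assumes p: "prime p" and tri: "triangular_coords p \<phi>"
    and mult: "\<And>c d. c \<in> digit_seqs p \<Longrightarrow> d \<in> digit_seqs p \<Longrightarrow>
      \<phi> k (\<lambda>i. c i * d i mod int p) = \<phi> k c * \<phi> k d mod int p"
  shows "\<exists>s>0. gcd s (p - 1) = 1 \<and> (\<forall>c\<in>digit_seqs p. \<phi> k c = c k ^ s mod int p)"
proof -
  have p1: "p > 1" by (rule prime_gt_1_nat[OF p])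
  define \<psi> where "\<psi> a = \<phi> k (\<lambda>j. a * unit_digits k j)" for a
  note sc = scaled_unit_digits_in_digit_seqs[of _ p k]
  have "\<exists>s>0. gcd s (p - 1) = 1 \<and> (\<forall>a\<in>{0..<int p}. \<psi> a = a ^ s mod int p)"
  proof (rule multiplicative_injection_is_power[OF p, of \<psi>])
    show "\<psi> a \<in> {0..<int p}" if "a \<in> {0..<int p}" for a
      using triangular_coords_range[OF tri sc[OF that]] by (simp add: \<psi>_def)
    show "\<psi> (a * b mod int p) = \<psi> a * \<psi> b mod int p" if "a \<in> {0..<int p}" "b \<in> {0..<int p}" for a b
    proof -
      have "(\<lambda>j. a * b mod int p * unit_digits k j) =
          (\<lambda>j. (a * unit_digits k j) * (b * unit_digits k j) mod int p)"
        by (auto simp: unit_digits_def)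
      then show ?thesis using mult[OF sc[OF that(1)] sc[OF that(2)]] by (simp add: \<psi>_def)
    qed
    show "inj_on \<psi> {0..<int p}"
    proof (rule inj_onI)
      fix a b assume ab: "a \<in> {0..<int p}" "b \<in> {0..<int p}" "\<psi> a = \<psi> b"
      then show "a = b"
        using triangular_coords_iff[OF tri sc[OF ab(1)] sc[OF ab(2)], of k]
        by (simp add: \<psi>_def unit_digits_def)
    qed
  qed
  then obtain s where s: "s > 0" "gcd s (p - 1) = 1"
    and pow: "\<forall>a\<in>{0..<int p}. \<psi> a = a ^ s mod int p" by metis
  show ?thesis
  proof (intro exI conjI ballI)
    fix c assume c: "c \<in> digit_seqs p"
    have one: "1 \<in> {0..<int p}" and ck: "c k \<in> {0..<int p}"
      using p1 digit_seqs_D[OF c, of k] by auto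
    have "(\<lambda>j. c k * unit_digits k j) = (\<lambda>j. c j * (1 * unit_digits k j) mod int p)"
      using digit_seqs_D[OF c, of k] by (auto simp: unit_digits_def)
    then have "\<psi> (c k) = \<phi> k c * \<psi> 1 mod int p"
      using mult[OF c sc[OF one]] by (simp add: \<psi>_def)
    moreover have "\<psi> 1 = 1" using bspec[OF pow one] p1 by simp
    ultimately have "\<psi> (c k) = \<phi> k c"
      using triangular_coords_range[OF tri c, of k] by simp
    then show "\<phi> k c = c k ^ s mod int p" using bspec[OF pow ck] by simp
  qed (fact s)+
qed

lemma padic_auto_AND:
  assumes p: "prime p"
  shows "padic_auto p (padic_AND p) =
    {f. \<exists>s :: nat \<Rightarrow> nat.
       (\<forall>k. s k > 0 \<and> gcd (s k) (p - 1) = 1) \<and>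
       f = digit_map p (\<lambda>k c. c k ^ s k mod int p)}"
    (is "_ = ?R")
proof -
  have p0: "p > 0" by (rule prime_gt_0_nat[OF p])
  have auto_eq: "padic_auto p (padic_AND p) =
    {f. \<exists>\<phi>. triangular_coords p \<phi> \<and>
       (\<forall>k. \<forall>c\<in>digit_seqs p. \<forall>d\<in>digit_seqs p.
          \<phi> k (\<lambda>i. c i * d i mod int p) = \<phi> k c * \<phi> k d mod int p) \<and>
       f = digit_map p \<phi>}"
    by (rule padic_auto_digitwise) (use p0 in \<open>auto simp: padic_AND_def residue_ring_def\<close>)
  show ?thesis
  proof (intro equalityI subsetI)
    fix f assume "f \<in> padic_auto p (padic_AND p)"
    then obtain \<phi> where tri: "triangular_coords p \<phi>"
      and mult: "\<And>k c d. c \<in> digit_seqs p \<Longrightarrow> d \<in> digit_seqs p \<Longrightarrow>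
        \<phi> k (\<lambda>i. c i * d i mod int p) = \<phi> k c * \<phi> k d mod int p"
      and f: "f = digit_map p \<phi>"
      unfolding auto_eq by blast
    have "\<exists>s>0. gcd s (p - 1) = 1 \<and> (\<forall>c\<in>digit_seqs p. \<phi> k c = c k ^ s mod int p)" for k
    proof (rule multiplicative_coords_power[where \<phi> = \<phi> and k = k, OF p tri])
      show "\<phi> k (\<lambda>i. c i * d i mod int p) = \<phi> k c * \<phi> k d mod int p"
        if "c \<in> digit_seqs p" "d \<in> digit_seqs p" for c d
        by (rule mult[OF that])
    qed
    then obtain s where s: "\<And>k. s k > 0 \<and> gcd (s k) (p - 1) = 1"
      and pow: "\<And>k c. c \<in> digit_seqs p \<Longrightarrow> \<phi> k c = c k ^ s k mod int p" by metis
    have "f = digit_map p (\<lambda>k c. c k ^ s k mod int p)"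
      unfolding f by (rule digit_map_cong[OF p0 pow])
    then show "f \<in> ?R" using s by blast
  next
    fix f assume "f \<in> ?R"
    then obtain s :: "nat \<Rightarrow> nat" where s: "\<forall>k. s k > 0 \<and> gcd (s k) (p - 1) = 1"
      and f: "f = digit_map p (\<lambda>k c. c k ^ s k mod int p)" by blast
    have "triangular_coords p (\<lambda>k c. c k ^ s k mod int p)"
      unfolding triangular_coords_def
    proof (intro conjI allI ballI impI)
      fix k c show "c k ^ s k mod int p \<in> {0..<int p}" using p0 by simp
    next
      fix k c d assume cd: "c \<in> digit_seqs p" "d \<in> digit_seqs p"
      then have "c k \<in> {0..<int p}" "d k \<in> {0..<int p}" by (auto simp: digit_seqs_def)
      then show "c k ^ s k mod int p = d k ^ s k mod int p \<longleftrightarrow> c k = d k"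
        using coprime_power_mod_prime_inj[of p "s k" "c k" "d k"] p s by auto
    qed
    moreover have "(c k * d k mod int p) ^ s k mod int p =
        (c k ^ s k mod int p) * (d k ^ s k mod int p) mod int p" for c d :: "nat \<Rightarrow> int" and k
      by (simp add: power_mod power_mult_distrib mod_mult_eq)
    ultimately show "f \<in> padic_auto p (padic_AND p)"
      unfolding auto_eq using f by blast
  qed
qed


section \<open>The automorphism groups\<close>

theorem theorem2p4:
  fixes p :: nat
  assumes "prime p"
  shows
    "carrier (padic_AutoGroup p (padic_XOR p)) =
       {f. \<exists>\<alpha> :: nat \<Rightarrow> nat \<Rightarrow> int.
             (\<forall>k. \<forall>i\<le>k. \<alpha> k i \<in> {0..int p - 1}) \<and>
             (\<forall>k. \<not> [\<alpha> k k = 0] (mod int p)) \<and>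
             f = (\<lambda>x\<in>padic_ints p. padic_series p (\<lambda>k.
                    \<Oplus>\<^bsub>residue_ring (int p)\<^esub>i\<in>{..k}.
                      \<alpha> k i \<otimes>\<^bsub>residue_ring (int p)\<^esub> padic_digit p x i))} \<and>
     carrier (padic_AutoGroup p (padic_AND p)) =
       {f. \<exists>s :: nat \<Rightarrow> nat.
             (\<forall>k. s k > 0 \<and> gcd (s k) (p - 1) = 1) \<and>
             f = (\<lambda>x\<in>padic_ints p. padic_series p (\<lambda>k.
                    padic_digit p x k ^ s k mod int p))}"
proof -
  have R: "residues (int p)"
    by (rule residues.intro) (use prime_gt_1_nat[OF assms] in simp)
  have "(\<Oplus>\<^bsub>residue_ring (int p)\<^esub>i\<in>{..k}. \<alpha> k i \<otimes>\<^bsub>residue_ring (int p)\<^esub> c i) =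
      (\<Sum>i\<le>k. \<alpha> k i * c i) mod int p" for \<alpha> :: "nat \<Rightarrow> nat \<Rightarrow> int" and k c
    unfolding residues.res_mult_eq[OF R] by (rule residues.sum_cong[OF R]) simp
  then show ?thesis
    using padic_auto_XOR[OF assms] padic_auto_AND[OF assms]
    by (simp add: padic_AutoGroup_def digit_map_def)
qed

end
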